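(* Let $\alpha:=(\log2)/2$ and let $c>0$ be an arbitrary real number. Then for all positive integers $s,n,d$ with $d\ge(1+c)s/(\alpha\log2)$, there exists a linear subspace $P\subset\mathbb{F}_2^{s\times n}$ with $\dim P\le d$ satisfying $$\mathrm{WF}(P)\le\left(1+\frac{1+c}{c}\,\frac1{\log2}\right)2^{-\alpha^2d^2/s}\,e^{2\alpha d}.$$
   Context: $\log$ is the natural logarithm. $\mathbb{F}_2^{s\times n}$ is the space of $s\times n$ matrices over $\mathbb{F}_2$, with zero matrix $O$. For $A,B\in\mathbb{F}_2^{s\times n}$ put $A\bullet B=(-1)^{\sum_{i,j}a_{i,j}b_{i,j}}$, and $P^\perp=\{A\in\mathbb{F}_2^{s\times n}:A\bullet B=1\text{ for all }B\in P\}$. The Dick weight is $\mu(A)=\sum_{i,j}j\,\delta(a_{i,j})$ with $\delta(0)=0$ and $\delta(1)=1$. The Walsh figure of merit (WAFOM) is $\mathrm{WF}(P)=\sum_{A\in P^\perp\setminus\{O\}}2^{-\mu(A)}$. *)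

theory Defs
  imports
    "HOL-Library.Z2"
    "Jordan_Normal_Form.VS_Connect"
begin

abbreviation mat_space :: "nat \<Rightarrow> nat \<Rightarrow> (bit, bit mat) module" where
  "mat_space s n \<equiv> module_mat TYPE(bit) s n"

lemma finite_carrier_mat_bit: "finite (carrier_mat s n :: bit mat set)"
proof (rule finite_imageD)
  let ?f = "\<lambda>A :: bit mat. {p \<in> {..<s} \<times> {..<n}. A $$ p = 1}"
  have "?f ` carrier_mat s n \<subseteq> Pow ({..<s} \<times> {..<n})"
    by auto
  then show "finite (?f ` carrier_mat s n)"
    by (rule finite_subset) simp
  show "inj_on ?f (carrier_mat s n)"
  proof (rule inj_onI)
    fix A B :: "bit mat"
    assume A: "A \<in> carrier_mat s n" and B: "B \<in> carrier_mat s n" and eq: "?f A = ?f B"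
    show "A = B"
    proof (rule eq_matI)
      fix i j
      assume "i < dim_row B" and "j < dim_col B"
      with B have "(i, j) \<in> {..<s} \<times> {..<n}"
        by auto
      with eq have "A $$ (i, j) = 1 \<longleftrightarrow> B $$ (i, j) = 1"
        by blast
      then show "A $$ (i, j) = B $$ (i, j)"
        by (cases "A $$ (i, j)"; cases "B $$ (i, j)") simp_all
    qed (use A B in auto)
  qed
qed

text \<open>The pairing \<open>A \<bullet> B\<close>: the exponent is an element of the two-element field, and
  \<^term>\<open>of_bit\<close> is its representative in \<open>{0, 1}\<close>.\<close>

definition walsh :: "bit mat \<Rightarrow> bit mat \<Rightarrow> int" where
  "walsh A B = (-1) ^ of_bit (\<Sum>i<dim_row A. \<Sum>j<dim_col A. A $$ (i, j) * B $$ (i, j))"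

definition walsh_perp :: "nat \<Rightarrow> nat \<Rightarrow> bit mat set \<Rightarrow> bit mat set" where
  "walsh_perp s n P = {A \<in> carrier_mat s n. \<forall>B\<in>P. walsh A B = 1}"

text \<open>Matrix entries are indexed from 0 here, so the column called \<open>j\<close> in the usual
  definition of the Dick weight has index \<open>j - 1\<close>.\<close>

definition dick_weight :: "bit mat \<Rightarrow> nat" where
  "dick_weight A = (\<Sum>i<dim_row A. \<Sum>j<dim_col A. Suc j * of_bit (A $$ (i, j)))"

definition WAFOM :: "nat \<Rightarrow> nat \<Rightarrow> bit mat set \<Rightarrow> real" where
  "WAFOM s n P = (\<Sum>A \<in> walsh_perp s n P - {0\<^sub>m s n}. 2 powr (- real (dick_weight A)))"

end

theory Submission
  imports Defs
begin

text \<open>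
  For a real threshold \<open>x\<close>, call a nonzero matrix light if its Dick weight is below \<open>x\<close>. If the
  dual \<open>P\<^sup>\<bottom>\<close> contains no light matrix, then \<open>WF(P)\<close> is at most the sum of \<open>2 powr (- \<mu>(A))\<close> over
  all matrices \<open>A\<close> of weight at least \<open>x\<close>, so two things have to be controlled: the number of
  light matrices and this tail.

  Both follow from one exponential moment. The generating function of the Dick weight factorizes
  (\<open>dick_weight_generating_function\<close>), which gives
  \<open>(\<Sum>A. exp (- u * \<mu>(A))) \<le> exp (s / u)\<close> for every \<open>u > 0\<close> (\<open>sum_exp_dick_weight_le\<close>).
  Chernoff's trick turns this into the two bounds \<open>e\<close> and \<open>2 powr (- x) * e\<close> with
  \<open>e = exp (u * x + s / u)\<close>: the first for the number of light matrices (\<open>card_light_less\<close>), the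
  second, for \<open>u \<le> ln 2\<close>, for the tail (\<open>sum_heavy_le\<close>).

  Light matrices are kept out of \<open>P\<^sup>\<bottom>\<close> as in the Gilbert--Varshamov bound. A fixed nonzero matrix
  is orthogonal to exactly half of all matrices, so by averaging some matrix is orthogonal to at
  most half of any given set of nonzero matrices. After \<open>d\<close> such choices, a set of fewer than
  \<open>2 ^ d\<close> matrices has been exhausted (\<open>exists_few_matrices_separating\<close>). The chosen matrices
  span \<open>P\<close>.

  Both bounds are best for \<open>u = sqrt (s / x)\<close>, where \<open>e = exp (2 * sqrt (s * x))\<close>. The largest
  \<open>x\<close> with \<open>e \<le> 2 ^ d\<close> is then \<open>\<alpha>\<^sup>2 * d\<^sup>2 / s\<close>; for it \<open>u = s / (\<alpha> * d)\<close> and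
  \<open>e = exp (2 * \<alpha> * d)\<close>, and the lower bound on \<open>d\<close> ensures \<open>u \<le> ln 2\<close>. The tail is thus estimated
  with constant 1, which is below \<open>1 + (1 + c) / (c * ln 2)\<close>.
\<close>

section \<open>The Walsh pairing\<close>

lemma walsh_cases: "walsh A B = 1 \<or> walsh A B = -1"
  by (cases "\<Sum>i<dim_row A. \<Sum>j<dim_col A. A $$ (i, j) * B $$ (i, j)") (simp_all add: walsh_def)

lemma walsh_add_unit:
  assumes A: "A \<in> carrier_mat s n" and B: "B \<in> carrier_mat s n"
    and k: "k < s" and l: "l < n" and A_kl: "A $$ (k, l) = 1"
  shows "walsh A (B + mat s n (\<lambda>p. if p = (k, l) then 1 else 0)) = - walsh A B"
proof -
  let ?E = "mat s n (\<lambda>p. if p = (k, l) then 1 else 0) :: bit mat"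
  let ?S = "\<Sum>i<s. \<Sum>j<n. A $$ (i, j) * B $$ (i, j)"
  have "(\<Sum>i<s. \<Sum>j<n. A $$ (i, j) * (B + ?E) $$ (i, j))
      = (\<Sum>i<s. \<Sum>j<n. A $$ (i, j) * B $$ (i, j) + (if i = k then if j = l then 1 else 0 else 0))"
    using B A_kl by (intro sum.cong refl) (auto simp: algebra_simps)
  also have "\<dots> = ?S + (\<Sum>i<s. \<Sum>j<n. if i = k then if j = l then 1 else 0 else 0)"
    by (simp only: sum.distrib)
  also have "(\<Sum>i<s. \<Sum>j<n. if i = k then if j = l then 1 else 0 else 0)
      = (\<Sum>i<s. if i = k then 1 else (0 :: bit))"
    by (intro sum.cong refl) (use l in simp)
  also have "\<dots> = 1"
    using k by simp
  finally have "(\<Sum>i<s. \<Sum>j<n. A $$ (i, j) * (B + ?E) $$ (i, j)) = ?S + 1" .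
  with A show ?thesis
    by (cases ?S) (simp_all add: walsh_def)
qed

text \<open>Orthogonality of characters: adding the unit matrix at a nonzero entry of \<open>A\<close> is a
  sign-reversing involution on the summands.\<close>

lemma sum_walsh_eq_0:
  assumes A: "A \<in> carrier_mat s n" and nz: "A \<noteq> 0\<^sub>m s n"
  shows "(\<Sum>B\<in>carrier_mat s n. walsh A B) = 0"
proof -
  obtain k l where k: "k < s" and l: "l < n" and "A $$ (k, l) \<noteq> 0"
    using A nz by (metis carrier_matD eq_matI index_zero_mat)
  then have A_kl: "A $$ (k, l) = 1" by simp
  define E :: "bit mat" where "E = mat s n (\<lambda>p. if p = (k, l) then 1 else 0)"
  have E: "E \<in> carrier_mat s n" by (simp add: E_def)
  have E_twice: "B + E + E = B" if "B \<in> carrier_mat s n" for B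
    by (rule eq_matI) (use that E in \<open>auto simp: E_def\<close>)
  have "(\<Sum>B\<in>carrier_mat s n. walsh A B) = (\<Sum>B\<in>carrier_mat s n. walsh A (B + E))"
    by (rule sum.reindex_bij_witness[where i = "\<lambda>B. B + E" and j = "\<lambda>B. B + E"])
      (use E E_twice in auto)
  also have "\<dots> = (\<Sum>B\<in>carrier_mat s n. - walsh A B)"
    using walsh_add_unit[OF A _ k l A_kl] by (simp add: E_def)
  finally show ?thesis
    by (simp add: sum_negf)
qed

text \<open>By \<open>sum_walsh_eq_0\<close>, the sum of \<open>walsh A B\<close> over \<open>A \<in> L\<close> vanishes on average over \<open>B\<close>. Where
  it is not positive, the values \<open>1\<close> do not outnumber the values \<open>-1\<close>.\<close>

lemma exists_halving_matrix:
  assumes L: "L \<subseteq> carrier_mat s n - {0\<^sub>m s n}"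
  shows "\<exists>B\<in>carrier_mat s n. 2 * card {A \<in> L. walsh A B = 1} \<le> card L"
proof -
  have fin: "finite L"
    using L finite_carrier_mat_bit finite_subset by blast
  have "(\<Sum>B\<in>carrier_mat s n. \<Sum>A\<in>L. walsh A B) = (\<Sum>A\<in>L. \<Sum>B\<in>carrier_mat s n. walsh A B)"
    by (rule sum.swap)
  also have "\<dots> = 0"
    using L sum_walsh_eq_0 by (intro sum.neutral) blast
  finally have total: "(\<Sum>B\<in>carrier_mat s n. \<Sum>A\<in>L. walsh A B) = 0" .
  have "\<exists>B\<in>carrier_mat s n. (\<Sum>A\<in>L. walsh A B) \<le> 0"
  proof (rule ccontr)
    assume "\<not> ?thesis"
    then have pos: "0 < (\<Sum>A\<in>L. walsh A B)" if "B \<in> carrier_mat s n" for B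
      using that by (auto simp: not_le)
    have "carrier_mat s n \<noteq> ({} :: bit mat set)"
      using zero_carrier_mat by blast
    then have "0 < (\<Sum>B\<in>carrier_mat s n. \<Sum>A\<in>L. walsh A B)"
      using pos by (rule sum_pos[OF finite_carrier_mat_bit])
    with total show False by simp
  qed
  then obtain B where B: "B \<in> carrier_mat s n" and le: "(\<Sum>A\<in>L. walsh A B) \<le> 0" ..
  have "(\<Sum>A\<in>L. walsh A B) = (\<Sum>A\<in>L. 2 * of_bool (walsh A B = 1) - 1)"
  proof (intro sum.cong refl)
    show "walsh A B = 2 * of_bool (walsh A B = 1) - 1" for A
      using walsh_cases[of A B] by (elim disjE) simp_all
  qed
  also have "\<dots> = 2 * int (card {A \<in> L. walsh A B = 1}) - int (card L)"
    using fin by (simp add: sum_subtractf sum_distrib_left[symmetric] sum.If_cases of_bool_def Int_def conj_commute)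
  finally show ?thesis
    using B le by (intro bexI[of _ B]) auto
qed

lemma exists_few_matrices_separating:
  assumes "L \<subseteq> carrier_mat s n - {0\<^sub>m s n}" and "card L < 2 ^ d"
  shows "\<exists>S \<subseteq> carrier_mat s n. finite S \<and> card S \<le> d \<and> (\<forall>A\<in>L. \<exists>B\<in>S. walsh A B \<noteq> 1)"
  using assms
proof (induction d arbitrary: L)
  case 0
  moreover have "finite L"
    using "0.prems"(1) finite_carrier_mat_bit finite_subset by blast
  ultimately have "L = {}" by simp
  then show ?case by auto
next
  case (Suc d)
  obtain B where B: "B \<in> carrier_mat s n" and half: "2 * card {A \<in> L. walsh A B = 1} \<le> card L"
    using exists_halving_matrix[OF Suc.prems(1)] by blast
  let ?L' = "{A \<in> L. walsh A B = 1}"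
  have "card ?L' < 2 ^ d"
    using half Suc.prems(2) by simp
  moreover have "?L' \<subseteq> carrier_mat s n - {0\<^sub>m s n}"
    using Suc.prems(1) by blast
  ultimately obtain S where S: "S \<subseteq> carrier_mat s n" "finite S" "card S \<le> d"
    and sep: "\<forall>A\<in>?L'. \<exists>B\<in>S. walsh A B \<noteq> 1"
    using Suc.IH[of ?L'] by blast
  show ?case
  proof (intro exI[of _ "insert B S"] conjI)
    show "card (insert B S) \<le> Suc d"
      using S(3) card_insert_le_m1[of "Suc d" S B] by simp
  qed (use B S sep in auto)
qed

lemma exists_subspace_spanned_by:
  assumes S: "S \<subseteq> carrier_mat s n" and fin_S: "finite S"
  shows "\<exists>P. VectorSpace.subspace class_ring P (mat_space s n) \<and> S \<subseteq> P \<and>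
    vectorspace.dim class_ring ((mat_space s n)\<lparr>carrier := P\<rparr>) \<le> card S"
proof -
  interpret vectorspace "class_ring :: bit ring" "mat_space s n"
    by (rule matrix_vs)
  have S': "S \<subseteq> carrier (mat_space s n)"
    using S by (simp add: module_mat_simps)
  have sub: "VectorSpace.subspace class_ring (span S) (mat_space s n)"
    using S' by (rule span_is_subspace)
  have own: "S \<subseteq> span S"
    using S' by (rule in_own_span)
  interpret W: vectorspace "class_ring :: bit ring" "vs (span S)"
    using sub by (rule subspace_is_vs)
  have "W.span S = carrier (vs (span S))"
    using span_li_not_depend(1)[OF own span_is_submodule[OF S']] by simp
  then have "W.dim \<le> card S"
    using fin_S own by (intro W.gen_ge_dim) auto
  with sub own show ?thesis by blast
qed

section \<open>The distribution of the Dick weight\<close>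

text \<open>A matrix over the two-element field is the indicator of its support, and the Dick weight is
  additive over the support. Each position \<open>(i, j)\<close> therefore contributes an independent factor
  \<open>1 + z ^ Suc j\<close>.\<close>

lemma dick_weight_generating_function:
  fixes z :: "'a :: comm_semiring_1"
  shows "(\<Sum>A\<in>carrier_mat s n. z ^ dick_weight A) = (\<Prod>j<n. 1 + z ^ Suc j) ^ s"
proof -
  let ?I = "{..<s} \<times> {..<n}"
  let ?w = "\<lambda>p :: nat \<times> nat. z ^ Suc (snd p)"
  let ?supp = "\<lambda>A :: bit mat. {p \<in> ?I. A $$ p = 1}"
  let ?ind = "\<lambda>T. mat s n (\<lambda>p. if p \<in> T then 1 else 0) :: bit mat"
  have term_eq: "z ^ dick_weight A = prod ?w (?supp A)" if "A \<in> carrier_mat s n" for A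
  proof -
    have "z ^ dick_weight A = (\<Prod>i<s. \<Prod>j<n. z ^ (Suc j * of_bit (A $$ (i, j))))"
      by (simp only: dick_weight_def power_sum carrier_matD[OF that])
    also have "\<dots> = (\<Prod>p\<in>?I. z ^ (Suc (snd p) * of_bit (A $$ p)))"
      by (simp add: prod.cartesian_product case_prod_unfold)
    also have "\<dots> = (\<Prod>p\<in>?I. if A $$ p = 1 then ?w p else 1)"
      by (intro prod.cong refl) auto
    also have "\<dots> = prod ?w (?supp A)"
      by (rule prod.inter_filter[symmetric]) simp
    finally show ?thesis .
  qed
  have ind_supp: "?ind (?supp A) = A" if "A \<in> carrier_mat s n" for A
    by (rule eq_matI) (use that in auto)
  have "(\<Sum>A\<in>carrier_mat s n. z ^ dick_weight A) = (\<Sum>T\<in>Pow ?I. prod ?w T)"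
    by (rule sum.reindex_bij_witness[where i = ?ind and j = ?supp])
      (use term_eq ind_supp in \<open>auto split: if_splits\<close>)
  also have "\<dots> = (\<Prod>p\<in>?I. ?w p + 1)"
    by (simp only: prod_add finite_cartesian_product finite_lessThan prod.neutral_const mult_1_right)
  also have "\<dots> = (\<Prod>i<s. \<Prod>j<n. 1 + z ^ Suc j)"
    unfolding prod.cartesian_product case_prod_unfold by (intro prod.cong refl add.commute)
  finally show ?thesis by simp
qed

text \<open>With \<open>z = exp (- u)\<close>, the estimate \<open>1 + y \<le> exp y\<close> bounds the generating function by the
  exponential of \<open>s\<close> times a geometric series, whose sum is at most
  \<open>z / (1 - z) = 1 / (exp u - 1) \<le> 1 / u\<close>.\<close>

lemma sum_exp_dick_weight_le:
  assumes u: "(u::real) > 0"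
  shows "(\<Sum>A\<in>carrier_mat s n. exp (- u * real (dick_weight A))) \<le> exp (real s / u)"
proof -
  define z where "z = exp (- u)"
  have z: "z > 0" by (simp add: z_def)
  have "u * z \<le> 1 - z"
    using exp_ge_add_one_self[of u] by (simp add: z_def exp_minus field_simps)
  then have "u * z * (\<Sum>j<n. z ^ j) \<le> (1 - z) * (\<Sum>j<n. z ^ j)"
    using z by (intro mult_right_mono sum_nonneg) auto
  also have "\<dots> = 1 - z ^ n"
    by (rule one_diff_power_eq[symmetric])
  also have "\<dots> \<le> 1"
    using z by simp
  finally have geometric: "(\<Sum>j<n. z ^ Suc j) \<le> 1 / u"
    using u by (simp add: sum_distrib_left field_simps)
  have "(\<Sum>A\<in>carrier_mat s n. exp (- u * real (dick_weight A)))
      = (\<Sum>A\<in>carrier_mat s n. z ^ dick_weight A)"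
    by (simp add: z_def exp_of_nat_mult[symmetric] mult.commute)
  also have "\<dots> = (\<Prod>j<n. 1 + z ^ Suc j) ^ s"
    by (rule dick_weight_generating_function)
  also have "\<dots> \<le> (\<Prod>j<n. exp (z ^ Suc j)) ^ s"
    using z by (intro power_mono prod_mono prod_nonneg) (auto intro: add_nonneg_nonneg simp del: power_Suc)
  also have "\<dots> = exp (\<Sum>j<n. z ^ Suc j) ^ s"
    by (simp add: exp_sum)
  also have "\<dots> \<le> exp (1 / u) ^ s"
    using geometric by (intro power_mono) auto
  also have "\<dots> = exp (real s / u)"
    by (simp add: exp_of_nat_mult[symmetric])
  finally show ?thesis .
qed

text \<open>Every matrix of weight below \<open>x\<close> contributes at least 1 to the sum of
  \<open>exp (u * (x - \<mu>(A)))\<close>. The zero matrix does as well, and it is not counted on the left: this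
  makes the inequality strict, as is necessary to stay below \<open>2 ^ d\<close>.\<close>

lemma card_light_less:
  assumes u: "(u::real) > 0" and x: "x \<ge> 0"
  shows "real (card {A \<in> carrier_mat s n - {0\<^sub>m s n}. real (dick_weight A) < x})
    < exp (u * x + real s / u)"
proof -
  let ?C = "carrier_mat s n :: bit mat set"
  let ?L = "{A \<in> ?C - {0\<^sub>m s n}. real (dick_weight A) < x}"
  let ?f = "\<lambda>A. exp (u * (x - real (dick_weight A)))"
  have fin: "finite ?C" by (rule finite_carrier_mat_bit)
  have "dick_weight (0\<^sub>m s n) = 0"
    by (simp add: dick_weight_def del: mult_Suc)
  then have ge1: "1 \<le> ?f A" if "A \<in> insert (0\<^sub>m s n) ?L" for A
    using that u x by auto
  have "real (card ?L) < real (card (insert (0\<^sub>m s n) ?L))"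
    using fin by simp
  also have "\<dots> = (\<Sum>A\<in>insert (0\<^sub>m s n) ?L. 1)"
    by simp
  also have "\<dots> \<le> (\<Sum>A\<in>insert (0\<^sub>m s n) ?L. ?f A)"
    by (rule sum_mono) (rule ge1)
  also have "\<dots> \<le> (\<Sum>A\<in>?C. ?f A)"
    by (rule sum_mono2[OF fin]) auto
  also have "\<dots> = exp (u * x) * (\<Sum>A\<in>?C. exp (- u * real (dick_weight A)))"
    by (simp add: sum_distrib_left exp_add[symmetric] algebra_simps)
  also have "\<dots> \<le> exp (u * x) * exp (real s / u)"
    using sum_exp_dick_weight_le[OF u] by (intro mult_left_mono) auto
  finally show ?thesis
    by (simp add: exp_add)
qed

text \<open>On matrices of weight at least \<open>x\<close>, the summand \<open>2 powr (- \<mu>(A))\<close> is at most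
  \<open>2 powr (- x) * exp (u * (x - \<mu>(A)))\<close> because \<open>u \<le> ln 2\<close>.\<close>

lemma sum_heavy_le:
  assumes u: "0 < (u::real)" "u \<le> ln 2"
    and H: "H \<subseteq> carrier_mat s n" and heavy: "\<And>A. A \<in> H \<Longrightarrow> x \<le> real (dick_weight A)"
  shows "(\<Sum>A\<in>H. 2 powr (- real (dick_weight A))) \<le> 2 powr (- x) * exp (u * x + real s / u)"
proof -
  have "(\<Sum>A\<in>H. 2 powr (- real (dick_weight A)))
      \<le> (\<Sum>A\<in>H. 2 powr (- x) * exp (u * x) * exp (- u * real (dick_weight A)))"
  proof (rule sum_mono)
    fix A assume "A \<in> H"
    then have "(ln 2 - u) * x \<le> (ln 2 - u) * real (dick_weight A)"
      using u heavy by (intro mult_left_mono) auto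
    then show "2 powr (- real (dick_weight A))
        \<le> 2 powr (- x) * exp (u * x) * exp (- u * real (dick_weight A))"
      by (simp add: powr_def exp_add[symmetric] algebra_simps)
  qed
  also have "\<dots> \<le> (\<Sum>A\<in>carrier_mat s n. 2 powr (- x) * exp (u * x) * exp (- u * real (dick_weight A)))"
    by (rule sum_mono2[OF finite_carrier_mat_bit H]) auto
  also have "\<dots> \<le> 2 powr (- x) * exp (u * x) * exp (real s / u)"
    using sum_exp_dick_weight_le[OF u(1)]
    by (simp only: sum_distrib_left[symmetric]) (intro mult_left_mono, auto)
  finally show ?thesis
    by (simp add: exp_add mult.assoc)
qed

section \<open>Existence of subspaces with small figure of merit\<close>

lemma exists_subspace_WAFOM_le:
  assumes u: "0 < (u::real)" "u \<le> ln 2" and x: "x \<ge> 0"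
    and d: "exp (u * x + real s / u) \<le> 2 ^ d"
  shows "\<exists>P. VectorSpace.subspace class_ring P (mat_space s n) \<and>
      vectorspace.dim class_ring ((mat_space s n)\<lparr>carrier := P\<rparr>) \<le> d \<and>
      WAFOM s n P \<le> 2 powr (- x) * exp (u * x + real s / u)"
proof -
  let ?L = "{A \<in> carrier_mat s n - {0\<^sub>m s n}. real (dick_weight A) < x}"
  have "real (card ?L) < real (2 ^ d)"
    using order_less_le_trans[OF card_light_less[OF u(1) x, of s n] d]
    by simp
  then have card_L: "card ?L < 2 ^ d"
    by (rule of_nat_less_imp_less)
  have "?L \<subseteq> carrier_mat s n - {0\<^sub>m s n}"
    by blast
  from exists_few_matrices_separating[OF this card_L]
  obtain S where S: "S \<subseteq> carrier_mat s n" "finite S" "card S \<le> d"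
    and sep: "\<forall>A\<in>?L. \<exists>B\<in>S. walsh A B \<noteq> 1"
    by (elim exE conjE)
  obtain P where P: "VectorSpace.subspace class_ring P (mat_space s n)" "S \<subseteq> P"
    "vectorspace.dim class_ring ((mat_space s n)\<lparr>carrier := P\<rparr>) \<le> card S"
    using exists_subspace_spanned_by[OF S(1,2)] by blast
  have "WAFOM s n P \<le> 2 powr (- x) * exp (u * x + real s / u)"
    unfolding WAFOM_def
  proof (rule sum_heavy_le[OF u])
    fix A assume "A \<in> walsh_perp s n P - {0\<^sub>m s n}"
    then have A: "A \<in> carrier_mat s n - {0\<^sub>m s n}" and "\<forall>B\<in>S. walsh A B = 1"
      using P(2) by (auto simp: walsh_perp_def)
    with sep have "A \<notin> ?L" by blast
    with A show "x \<le> real (dick_weight A)" by auto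
  qed (auto simp: walsh_perp_def)
  with P(1) order_trans[OF P(3) S(3)] show ?thesis by blast
qed

theorem corollary5p14:
  fixes \<alpha> c :: real and s n d :: nat
  defines "\<alpha> \<equiv> ln 2 / 2"
  assumes "c > 0" and "s > 0" and "n > 0" and "d > 0"
    and "real d \<ge> (1 + c) * real s / (\<alpha> * ln 2)"
  shows "\<exists>P. VectorSpace.subspace class_ring P (mat_space s n) \<and>
      vectorspace.dim class_ring ((mat_space s n)\<lparr>carrier := P\<rparr>) \<le> d \<and>
      WAFOM s n P \<le> (1 + (1 + c) / c * (1 / ln 2))
        * 2 powr (- (\<alpha>\<^sup>2 * (real d)\<^sup>2 / real s)) * exp (2 * \<alpha> * real d)"
proof -
  have \<alpha>: "\<alpha> > 0" by (simp add: \<alpha>_def)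
  (* u minimizes u * x + s / u, and x is chosen so that the minimum is d * ln 2. *)
  define u where "u = real s / (\<alpha> * real d)"
  define x where "x = \<alpha>\<^sup>2 * (real d)\<^sup>2 / real s"
  have u_pos: "u > 0"
    using \<alpha> assms by (simp add: u_def)
  have "real s \<le> (1 + c) * real s"
    using assms by simp
  also have "\<dots> \<le> real d * (\<alpha> * ln 2)"
    using assms(6) \<alpha> by (simp add: pos_divide_le_eq)
  finally have u_le: "u \<le> ln 2"
    using \<alpha> assms(5) by (simp add: u_def pos_divide_le_eq mult_ac)
  have exponent: "u * x + real s / u = 2 * \<alpha> * real d"
    using \<alpha> assms(3,5) by (simp add: u_def x_def field_simps power2_eq_square)
  have "exp (2 * \<alpha> * real d) = 2 ^ d"
    by (simp add: \<alpha>_def exp_of_nat2_mult)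
  then obtain P where P: "VectorSpace.subspace class_ring P (mat_space s n)"
    "vectorspace.dim class_ring ((mat_space s n)\<lparr>carrier := P\<rparr>) \<le> d"
    and WAFOM: "WAFOM s n P \<le> 2 powr (- x) * exp (2 * \<alpha> * real d)"
    using exists_subspace_WAFOM_le[OF u_pos u_le, of x s d n] exponent
    by (auto simp: x_def)
  have "1 * (2 powr (- x) * exp (2 * \<alpha> * real d))
      \<le> (1 + (1 + c) / c * (1 / ln 2)) * (2 powr (- x) * exp (2 * \<alpha> * real d))"
    using assms(2) by (intro mult_right_mono) auto
  from order_trans[OF _ this] WAFOM
  have "WAFOM s n P \<le> (1 + (1 + c) / c * (1 / ln 2))
      * 2 powr (- (\<alpha>\<^sup>2 * (real d)\<^sup>2 / real s)) * exp (2 * \<alpha> * real d)"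
    unfolding x_def by (simp only: mult.assoc mult_1_left)
  with P show ?thesis by blast
qed

end
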